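(* Let $s,t$ be integers with $s,t>1$ and $\gcd(s,t)=1$. Let $\nu(s,t)$ be the number of distinct complex values taken by $\mathrm{GBG\text{-}rank}(\pi,s)$ as $\pi$ ranges over all $t$-cores. Then \[ \nu(s,t)\le \frac{1}{t+s}\binom{t+s}{t}. \]
   Context: Let $\omega_s=e^{2\pi I/s}$, $I=\sqrt{-1}$. For a partition $\pi$ with Young diagram cells $(i,j)$ (row $i$, column $j$), and $0\le k\le s-1$, $r_k(\pi,s)$ is the number of cells with $j-i\equiv k\pmod s$; $\mathrm{GBG\text{-}rank}(\pi,s)=\sum_{k=0}^{s-1} r_k(\pi,s)\omega_s^k$. A rim hook of $\pi$ is a connected collection of rim cells (cells sharing a vertex or edge with the boundary of the diagram) whose removal leaves the diagram of a partition; $\pi$ is a $t$-core if it has no rim hook of length $t$. *)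

theory Defs
  imports Complex_Main "HOL-Number_Theory.Cong"
begin

definition is_partition :: "nat list \<Rightarrow> bool" where
  "is_partition \<pi> \<longleftrightarrow> sorted_wrt (\<ge>) \<pi> \<and> (\<forall>p\<in>set \<pi>. p > 0)"

(* Rows and columns are numbered from 0; the content j - i is the same as with numbering from 1. *)
definition diagram :: "nat list \<Rightarrow> (nat \<times> nat) set" where
  "diagram \<pi> = {(i, j). i < length \<pi> \<and> j < \<pi> ! i}"

definition residue_count :: "nat list \<Rightarrow> nat \<Rightarrow> nat \<Rightarrow> nat" where
  "residue_count \<pi> s k = card {(i, j) \<in> diagram \<pi>. [int j - int i = int k] (mod int s)}"

definition root_unity :: "nat \<Rightarrow> complex" where
  "root_unity s = exp (2 * of_real pi * \<i> / of_nat s)"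

definition GBG_rank :: "nat list \<Rightarrow> nat \<Rightarrow> complex" where
  "GBG_rank \<pi> s = (\<Sum>k = 0..s - 1. of_nat (residue_count \<pi> s k) * root_unity s ^ k)"

(* Two unit squares share a vertex (in particular if they share an edge). *)
definition share_vertex :: "nat \<times> nat \<Rightarrow> nat \<times> nat \<Rightarrow> bool" where
  "share_vertex c d \<longleftrightarrow>
     \<bar>int (fst c) - int (fst d)\<bar> \<le> 1 \<and> \<bar>int (snd c) - int (snd d)\<bar> \<le> 1"

definition share_edge :: "nat \<times> nat \<Rightarrow> nat \<times> nat \<Rightarrow> bool" where
  "share_edge c d \<longleftrightarrow>
     \<bar>int (fst c) - int (fst d)\<bar> + \<bar>int (snd c) - int (snd d)\<bar> = 1"

(* The boundary here is the south-east one, i.e. the zigzag line separating the diagram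
   from the rest of the quadrant; a cell meets that line in a vertex or an edge iff it
   shares a vertex with some square of the quadrant outside the diagram.  The top and left
   sides of the diagram do not count: all squares have coordinates in nat. *)
definition rim :: "nat list \<Rightarrow> (nat \<times> nat) set" where
  "rim \<pi> = {c \<in> diagram \<pi>. \<exists>d. d \<notin> diagram \<pi> \<and> share_vertex c d}"

(* Connected through edges, not merely through vertices. *)
definition connected_cells :: "(nat \<times> nat) set \<Rightarrow> bool" where
  "connected_cells H \<longleftrightarrow>
     (\<forall>c\<in>H. \<forall>d\<in>H. (c, d) \<in> {(x, y). x \<in> H \<and> y \<in> H \<and> share_edge x y}\<^sup>*)"

definition is_rim_hook :: "nat list \<Rightarrow> (nat \<times> nat) set \<Rightarrow> bool" where
  "is_rim_hook \<pi> H \<longleftrightarrow> H \<subseteq> rim \<pi> \<and> connected_cells H \<and>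
     (\<exists>\<rho>. is_partition \<rho> \<and> diagram \<rho> = diagram \<pi> - H)"

definition is_core :: "nat \<Rightarrow> nat list \<Rightarrow> bool" where
  "is_core t \<pi> \<longleftrightarrow> is_partition \<pi> \<and> \<not> (\<exists>H. is_rim_hook \<pi> H \<and> card H = t)"

definition core_ranks :: "nat \<Rightarrow> nat \<Rightarrow> complex set" where
  "core_ranks s t = {GBG_rank \<pi> s | \<pi>. is_core t \<pi>}"

definition nu :: "nat \<Rightarrow> nat \<Rightarrow> nat" where
  "nu s t = card (core_ranks s t)"

end

theory Submission
  imports Defs "HOL-Analysis.Complex_Transcendental"
begin

text \<open>
  Encode a partition by the numbers \<open>\<beta>\<^sub>i = \<pi>\<^sub>i - i\<close>. Summing each row of the diagram as a
  geometric series, with \<open>\<omega>\<close> the primitive \<open>s\<close>-th root of unity, turns \<open>(\<omega> - 1)\<close> times the rank into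
  \<open>\<Sum>\<omega>\<^bsup>\<beta>\<^esup>\<close> minus the same sum for the empty partition. For a \<open>t\<close>-core the set \<open>X\<close> of all \<open>\<beta>\<^sub>i\<close> is closed
  under subtracting \<open>t\<close>, so multiplying by \<open>\<omega>\<^sup>t - 1\<close> leaves only the sum over \<open>C = (X + t) - X\<close>. This set has
  \<open>t\<close> elements, whose sum is the same for all cores, and only the multiset of residues of \<open>C\<close> modulo \<open>s\<close>
  matters. Rotating \<open>\<int>/s\<close> changes the sum of such a multiset by \<open>t\<close>, which is coprime to \<open>s\<close>; so at most one
  in \<open>s\<close> of the \<open>(t + s - 1) choose t\<close> multisets has the required sum.
\<close>

section \<open>Multisets of residues and their rotations\<close>

text \<open>A multiset of residues modulo \<open>s\<close> is represented by its list of \<open>s\<close> multiplicities.\<close>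

definition weight :: "nat list \<Rightarrow> nat" where
  "weight l = (\<Sum>k<length l. k * l ! k)"

text \<open>\<open>weight\<close> is the sum of the represented multiset. Moving the head to the end
  lowers every other index by one and raises that of the head from 0 to
  \<open>length l - 1\<close>.\<close>

lemma weight_rotate1:
  "weight (rotate1 l) + sum_list l = weight l + length l * hd l" if "l \<noteq> []"
proof (cases l)
  case (Cons x xs)
  have "weight (xs @ [x]) = (\<Sum>k<length xs. k * xs ! k) + length xs * x"
    by (simp add: weight_def nth_append)
  moreover have "weight (x # xs) = (\<Sum>k<length xs. k * xs ! k) + sum_list xs"
    by (simp add: weight_def sum.lessThan_Suc_shift sum.distrib sum_list_sum_nth
        atLeast0LessThan del: sum.lessThan_Suc)
  ultimately show ?thesis using Cons by simp
qed (use that in simp)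

lemma sum_list_rotate: "sum_list (rotate m l) = sum_list (l :: nat list)"
proof (induction m)
  case (Suc m)
  have "sum_list (rotate1 xs) = sum_list xs" for xs :: "nat list" by (cases xs) auto
  then show ?case using Suc by simp
qed simp

lemma weight_rotate:
  assumes "l \<noteq> []"
  shows "[weight (rotate m l) + m * sum_list l = weight l] (mod length l)"
proof (induction m)
  case (Suc m)
  have ne: "rotate m l \<noteq> []" using assms by simp
  have "weight (rotate (Suc m) l) + Suc m * sum_list l
      = (weight (rotate m l) + m * sum_list l) + length l * hd (rotate m l)"
    using weight_rotate1[OF ne] by (simp add: sum_list_rotate)
  also have "[\<dots> = weight l + 0] (mod length l)"
    by (rule cong_add[OF Suc]) (simp add: cong_def)
  finally show ?case by simp
qed simp

lemma finite_lists_sum: "finite {l :: nat list. length l = s \<and> sum_list l = N}"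
proof (rule finite_subset)
  show "{l :: nat list. length l = s \<and> sum_list l = N} \<subseteq> {l. set l \<subseteq> {..N} \<and> length l = s}"
    using member_le_sum_list by fastforce
qed (simp add: finite_lists_length_eq)

text \<open>Rotating by \<open>m\<close> shifts the weight by \<open>- m * t\<close> modulo
  \<open>s\<close>. As \<open>t\<close> is invertible modulo \<open>s\<close>, the \<open>s\<close>
  rotated copies of \<open>E\<close> are disjoint; all lie in \<open>T\<close>, which stars and bars
  counts.\<close>

lemma card_lists_weight:
  fixes s t :: nat
  assumes "s > 0" and "coprime s t"
  shows "s * card {l. length l = s \<and> sum_list l = t \<and> [weight l = a] (mod s)} \<le> (t + s - 1) choose t"
proof -
  define E where "E = {l. length l = s \<and> sum_list l = t \<and> [weight l = a] (mod s)}"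
  define T where "T = {l :: nat list. length l = s \<and> sum_list l = t}"
  have finT: "finite T" unfolding T_def by (rule finite_lists_sum)
  then have finE: "finite E" by (rule finite_subset[rotated]) (auto simp: E_def T_def)
  have ET: "rotate m ` E \<subseteq> T" for m
    by (auto simp: E_def T_def sum_list_rotate)
  have disj: "rotate m ` E \<inter> rotate m' ` E = {}" if "m < s" "m' < s" "m \<noteq> m'" for m m'
  proof (rule ccontr)
    assume "rotate m ` E \<inter> rotate m' ` E \<noteq> {}"
    then obtain l l' where l: "l \<in> E" "l' \<in> E" "rotate m l = rotate m' l'" by blast
    have ne: "l \<noteq> []" "l' \<noteq> []" using l assms by (auto simp: E_def)
    have "[weight (rotate m l) + m * t = a] (mod s)"
      using weight_rotate[OF ne(1), of m] l(1) by (auto simp: E_def intro: cong_trans)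
    moreover have "[weight (rotate m l) + m' * t = a] (mod s)"
      using weight_rotate[OF ne(2), of m'] l by (auto simp: E_def intro: cong_trans)
    ultimately have "[weight (rotate m l) + m * t = weight (rotate m l) + m' * t] (mod s)"
      by (meson cong_sym cong_trans)
    then have "[m * t = m' * t] (mod s)" by (simp add: cong_add_lcancel_nat)
    then have "[m = m'] (mod s)" using assms by (simp add: cong_mult_rcancel_nat coprime_commute)
    then show False using that by (simp add: cong_def)
  qed
  have "inj_on (rotate m) E" for m
    unfolding rotate_def by (rule inj_on_subset[OF inj_fn[OF inj_rotate1]]) simp
  then have "s * card E = (\<Sum>m<s. card (rotate m ` E))" by (simp add: card_image)
  also have "\<dots> = card (\<Union>m<s. rotate m ` E)"
    using disj finE by (intro card_UN_disjoint[symmetric]) auto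
  also have "\<dots> \<le> card T" using ET finT by (intro card_mono) auto
  finally show ?thesis by (simp add: E_def T_def card_length_sum_list)
qed

section \<open>Roots of unity and sums over residues\<close>

lemma root_unity_power_eq_1_iff:
  assumes "s > 0" shows "root_unity s ^ m = 1 \<longleftrightarrow> s dvd m"
  using complex_root_unity_eq_1[of s m] assms
  by (simp add: root_unity_def mult_ac flip: exp_of_nat_mult)

lemma root_unity_powi_cong:
  assumes "s > 0" "[a = b] (mod int s)"
  shows "root_unity s powi a = root_unity s powi b"
proof -
  obtain k where k: "a = b + int s * k" using assms by (metis cong_iff_lin cong_sym)
  have nz: "root_unity s \<noteq> 0" by (simp add: root_unity_def)
  have "root_unity s ^ s = 1" using assms by (simp add: root_unity_power_eq_1_iff)
  then have "root_unity s powi (int s * k) = 1" by (simp add: power_int_mult)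
  then show ?thesis using nz by (simp add: k power_int_add)
qed

lemma sum_fibers:
  fixes h :: "nat \<Rightarrow> 'b::semiring_1"
  assumes "finite C" "g ` C \<subseteq> {..<s}"
  shows "(\<Sum>c\<in>C. h (g c)) = (\<Sum>k<s. of_nat (card {c \<in> C. g c = k}) * h k)"
proof -
  have "(\<Sum>c\<in>C. h (g c)) = (\<Sum>k<s. \<Sum>c\<in>{c \<in> C. g c = k}. h (g c))"
    using assms by (intro sum.group[symmetric]) auto
  then show ?thesis by simp
qed

section \<open>The rank in terms of beta-numbers\<close>

text \<open>Rows past the end have length zero, which makes \<open>beta\<close> an infinite sequence
  with \<open>beta \<pi> i = - i\<close> from index \<open>length \<pi>\<close> on.\<close>

definition row :: "nat list \<Rightarrow> nat \<Rightarrow> nat" where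
  "row \<pi> i = (if i < length \<pi> then \<pi> ! i else 0)"

lemma diagram_row: "diagram \<pi> = {(i, j). j < row \<pi> i}"
  by (auto simp: diagram_def row_def split: if_splits)

lemma diagram_Sigma: "diagram \<pi> = Sigma {..<length \<pi>} (\<lambda>i. {..<row \<pi> i})"
  by (auto simp: diagram_def row_def)

lemma GBG_rank_eq_sum_diagram:
  assumes "s > 0"
  shows "GBG_rank \<pi> s = (\<Sum>(i, j)\<in>diagram \<pi>. root_unity s powi (int j - int i))"
proof -
  define g where "g = (\<lambda>(i, j). nat ((int j - int i) mod int s))"
  have range: "{0..s - 1} = {..<s}" using assms by auto
  have fibre: "{c \<in> diagram \<pi>. g c = k} = {(i, j) \<in> diagram \<pi>. [int j - int i = int k] (mod int s)}"
    if "k < s" for k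
  proof -
    have "int k mod int s = int k" using that by simp
    then show ?thesis using assms by (auto simp: g_def cong_def nat_eq_iff)
  qed
  have "root_unity s powi (int j - int i) = root_unity s ^ g (i, j)" for i j
    using root_unity_powi_cong[OF assms, of "int j - int i" "(int j - int i) mod int s"] assms
    by (simp add: g_def power_int_def)
  then have "(\<Sum>(i, j)\<in>diagram \<pi>. root_unity s powi (int j - int i)) = (\<Sum>c\<in>diagram \<pi>. root_unity s ^ g c)"
    by (intro sum.cong) auto
  also have "\<dots> = (\<Sum>k<s. of_nat (card {c \<in> diagram \<pi>. g c = k}) * root_unity s ^ k)"
    using assms by (intro sum_fibers) (auto simp: diagram_Sigma g_def nat_less_iff)
  also have "\<dots> = (\<Sum>k<s. of_nat (residue_count \<pi> s k) * root_unity s ^ k)"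
    by (intro sum.cong) (auto simp: fibre residue_count_def)
  finally show ?thesis by (simp only: GBG_rank_def range)
qed

definition beta :: "nat list \<Rightarrow> nat \<Rightarrow> int" where
  "beta \<pi> i = int (row \<pi> i) - int i"

text \<open>The contents in row \<open>i\<close> run from \<open>- i\<close> to
  \<open>beta \<pi> i - 1\<close>, so each row is a geometric series that telescopes under the
  factor \<open>root_unity s - 1\<close>.\<close>

lemma GBG_rank_beta:
  assumes "s > 0"
  shows "(root_unity s - 1) * GBG_rank \<pi> s =
    (\<Sum>i<length \<pi>. root_unity s powi beta \<pi> i) - (\<Sum>i<length \<pi>. root_unity s powi (- int i))"
proof -
  define w where "w = root_unity s"
  have nz: "w \<noteq> 0" by (simp add: w_def root_unity_def)
  have row: "(w - 1) * (\<Sum>j<m. w powi (int j - int i)) = w powi (int m - int i) - w powi (- int i)" for m i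
  proof -
    have "(\<Sum>j<m. w powi (int j - int i)) = (\<Sum>j<m. w ^ j) * w powi (- int i)"
      using nz by (simp add: sum_distrib_right flip: power_int_add power_int_of_nat)
    then have "(w - 1) * (\<Sum>j<m. w powi (int j - int i)) = (w ^ m - 1) * w powi (- int i)"
      by (simp add: power_diff_1_eq)
    also have "\<dots> = w powi (int m + - int i) - w powi (- int i)"
      using nz by (subst power_int_add) (auto simp: algebra_simps)
    finally show ?thesis by simp
  qed
  have "GBG_rank \<pi> s = (\<Sum>i<length \<pi>. \<Sum>j<row \<pi> i. w powi (int j - int i))"
    by (simp add: GBG_rank_eq_sum_diagram[OF assms] w_def sum.Sigma diagram_Sigma)
  then have "(w - 1) * GBG_rank \<pi> s = (\<Sum>i<length \<pi>. w powi (int (row \<pi> i) - int i) - w powi (- int i))"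
    by (simp only: sum_distrib_left[of "w - 1" _ "{..<length \<pi>}"] row)
  then show ?thesis by (simp add: w_def beta_def sum_subtractf)
qed

section \<open>Rim hooks and beta-numbers of cores\<close>

lemma antimono_row: "is_partition \<pi> \<Longrightarrow> antimono (row \<pi>)"
  by (auto simp: row_def is_partition_def sorted_wrt_iff_nth_less antimono_iff_le_Suc)

lemma beta_strict_decreasing:
  assumes "is_partition \<pi>" "i < j" shows "beta \<pi> j < beta \<pi> i"
  using antimonoD[OF antimono_row[OF assms(1)], of i j] assms(2) by (simp add: beta_def)

text \<open>The list is cut at the first zero of \<open>g\<close>, because the parts of a partition
  must be positive.\<close>

lemma partition_of_antitone:
  fixes g :: "nat \<Rightarrow> nat"
  assumes "antimono g" "g N = 0"
  obtains \<rho> where "is_partition \<rho>" "diagram \<rho> = {(i, j). j < g i}"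
proof -
  define n where "n = (LEAST n. g n = 0)"
  have gn: "g n = 0" unfolding n_def by (rule LeastI[of _ N]) (rule assms)
  have pos: "g i > 0" if "i < n" for i using not_less_Least that unfolding n_def by blast
  have zero: "i < n" if "j < g i" for i j
  proof (rule ccontr)
    assume "\<not> i < n"
    then have "g i \<le> g n" using assms(1) by (simp add: antimonoD)
    then show False using gn that by simp
  qed
  have "is_partition (map g [0..<n])"
    using pos assms(1) by (auto simp: is_partition_def sorted_wrt_iff_nth_less antimonoD)
  moreover have "diagram (map g [0..<n]) = {(i, j). j < g i}"
    using zero by (auto simp: diagram_def)
  ultimately show ?thesis using that by blast
qed

text \<open>By \<open>size\<close>, the integer \<open>p - k\<close> is
  \<open>beta \<pi> i - t\<close>; the bounds put it strictly between
  \<open>beta \<pi> (Suc k)\<close> and \<open>beta \<pi> k\<close>. Replacing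
  \<open>beta \<pi> i\<close> by it and sorting again gives rows \<open>i\<close> to
  \<open>k - 1\<close> the beta-number of the next row and row \<open>k\<close> the new one; the
  cells lost form the hook.\<close>

lemma rim_hook_exists:
  assumes "is_partition \<pi>" and "i \<le> k"
    and lower: "row \<pi> (Suc k) \<le> p" and upper: "p < row \<pi> k" and size: "p + i + t = row \<pi> i + k"
  shows "\<exists>H. is_rim_hook \<pi> H \<and> card H = t"
proof -
  define f where "f = row \<pi>"
  have f_anti: "f b \<le> f a" if "a \<le> b" for a b
    using antimonoD[OF antimono_row[OF assms(1)] that] by (simp add: f_def)
  have lower: "f (Suc k) \<le> p" and upper: "p < f k" and size: "p + i + t = f i + k"
    using assms by (simp_all add: f_def)
  \<comment> \<open>the row lengths left after removing the hook that starts in row \<open>i\<close> and ends in row \<open>k\<close>\<close>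
  define g where "g j = (if j < i \<or> k < j then f j else if j < k then f (Suc j) - 1 else p)" for j
  have f_pos: "f j > 0" if "j \<le> k" for j using f_anti[OF that] upper by simp
  have g_le: "g j \<le> f j" for j
    using f_anti[of j "Suc j"] upper by (auto simp: g_def)
  have "g (Suc j) \<le> g j" for j
  proof -
    consider "Suc j < i" | "Suc j = i" | "i \<le> j" "Suc j < k" | "i \<le> j" "Suc j = k" | "i \<le> j" "j = k" | "k < j"
      by linarith
    then show ?thesis
    proof cases
      case 2
      then have "g j = f j" by (simp add: g_def)
      then show ?thesis using g_le[of "Suc j"] f_anti[of j "Suc j"] by simp
    qed (use f_anti[of j "Suc j"] f_anti[of "Suc j" "Suc (Suc j)"] lower upper \<open>i \<le> k\<close> in \<open>auto simp: g_def\<close>)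
  qed
  then have "antimono g" by (simp add: antimono_iff_le_Suc)
  moreover have "g (Suc k + length \<pi>) = 0" by (simp add: g_def f_def row_def)
  ultimately obtain \<rho> where \<rho>: "is_partition \<rho>" "diagram \<rho> = {(a, b). b < g a}"
    by (rule partition_of_antitone)
  define H where "H = Sigma {i..k} (\<lambda>j. {g j..<f j})"
  have H_iff: "(j, c) \<in> H \<longleftrightarrow> i \<le> j \<and> j \<le> k \<and> g j \<le> c \<and> c < f j" for j c
    by (auto simp: H_def)
  have out: "g j = f j" if "j < i \<or> k < j" for j using that by (simp add: g_def)
  have diag: "diagram \<rho> = diagram \<pi> - H"
  proof -
    have "(j, c) \<in> diagram \<rho> \<longleftrightarrow> (j, c) \<in> diagram \<pi> - H" for j c
      unfolding \<rho>(2) using out[of j] g_le[of j]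
      by (auto simp: diagram_row H_iff f_def[symmetric])
    then show ?thesis by auto
  qed
  have rim: "H \<subseteq> rim \<pi>"
  proof
    fix x assume "x \<in> H"
    then obtain j c where x: "x = (j, c)" and jc: "i \<le> j" "j \<le> k" "g j \<le> c" "c < f j"
      by (auto simp: H_def)
    \<comment> \<open>The diagonal south-east neighbour of a hook cell lies outside the diagram and
      witnesses that the cell is on the rim.\<close>
    have "f (Suc j) \<le> Suc c" using jc lower by (cases "j = k") (auto simp: g_def)
    then have "(Suc j, Suc c) \<notin> diagram \<pi>" by (simp add: diagram_row f_def)
    moreover have "share_vertex x (Suc j, Suc c)" by (simp add: x share_vertex_def)
    moreover have "x \<in> diagram \<pi>" using jc by (simp add: x diagram_row f_def)
    ultimately show "x \<in> rim \<pi>" unfolding rim_def by blast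
  qed
  define R where "R = {(x, y). x \<in> H \<and> y \<in> H \<and> share_edge x y}"
  have along_row: "((j, c), (j, c + n)) \<in> R\<^sup>*" if "(j, c) \<in> H" "c + n < f j" for j c n
    using that(2)
  proof (induction n)
    case (Suc n)
    then have "((j, c + n), (j, c + Suc n)) \<in> R"
      using that by (auto simp: R_def H_iff share_edge_def)
    then show ?case using Suc by (auto intro: rtrancl_into_rtrancl)
  qed simp
  \<comment> \<open>Every cell is joined to the last cell of row \<open>i\<close>: go right to the
    end of the row, then up. The cell reached is in \<open>H\<close>, since the hook in the upper
    row starts exactly in that column \<open>e\<close>.\<close>
  have to_end: "((i + d, c), (i, f i - 1)) \<in> R\<^sup>*" if "(i + d, c) \<in> H" for d c
    using that
  proof (induction d arbitrary: c)
    case 0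
    then show ?case using along_row[of i c "f i - 1 - c"] by (auto simp: H_iff)
  next
    case (Suc d)
    define e where "e = f (Suc (i + d)) - 1"
    have c: "c \<le> e" "i + d < k" "e < f (Suc (i + d))" using Suc.prems by (auto simp: H_iff e_def)
    have "((i + Suc d, c), (i + Suc d, e)) \<in> R\<^sup>*"
      using along_row[of "i + Suc d" c "e - c"] Suc.prems c by simp
    moreover have mid: "(i + d, e) \<in> H"
      using c f_anti[of "i + d" "Suc (i + d)"] by (auto simp: H_iff g_def e_def)
    have "(i + Suc d, e) \<in> H" using Suc.prems c by (auto simp: H_iff)
    with mid have "((i + Suc d, e), (i + d, e)) \<in> R" by (auto simp: R_def share_edge_def)
    ultimately show ?case using Suc.IH[OF mid]
      by (meson converse_rtrancl_into_rtrancl rtrancl_trans)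
  qed
  have "sym R" by (auto simp: sym_def R_def share_edge_def)
  then have symR: "(x, y) \<in> R\<^sup>* \<Longrightarrow> (y, x) \<in> R\<^sup>*" for x y by (meson sym_rtrancl symD)
  have to_end': "(x, (i, f i - 1)) \<in> R\<^sup>*" if "x \<in> H" for x
    using to_end[of "fst x - i" "snd x"] that by (cases x) (auto simp: H_iff)
  have "connected_cells H"
    unfolding connected_cells_def R_def[symmetric]
    using to_end' symR by (meson rtrancl_trans)
  moreover have "card H = t"
  proof -
    have ik: "{i..k} = insert k {i..<k}" using \<open>i \<le> k\<close> by auto
    have "int (card H) = (\<Sum>j\<in>{i..k}. int (f j) - int (g j))"
      using g_le by (simp add: H_def of_nat_diff)
    also have "\<dots> = (int (f k) - int p) + (\<Sum>j\<in>{i..<k}. int (f j) - int (g j))"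
      using \<open>i \<le> k\<close> by (simp add: ik) (simp add: g_def)
    \<comment> \<open>A row \<open>j < k\<close> loses \<open>f j - f (Suc j) + 1\<close> cells, a
      difference of consecutive values of \<open>j - f j\<close>, so the sum telescopes.\<close>
    also have "(\<Sum>j\<in>{i..<k}. int (f j) - int (g j))
        = (\<Sum>j\<in>{i..<k}. (int (Suc j) - int (f (Suc j))) - (int j - int (f j)))"
    proof (rule sum.cong)
      fix j assume "j \<in> {i..<k}"
      then show "int (f j) - int (g j) = (int (Suc j) - int (f (Suc j))) - (int j - int (f j))"
        using f_pos[of "Suc j"] by (simp add: g_def of_nat_diff)
    qed simp
    also have "\<dots> = (int k - int (f k)) - (int i - int (f i))"
      by (rule sum_Suc_diff'[OF \<open>i \<le> k\<close>])
    finally show ?thesis using size by simp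
  qed
  ultimately show ?thesis
    using rim diag \<rho>(1) unfolding is_rim_hook_def by blast
qed

text \<open>If \<open>beta \<pi> i - t\<close> were not a beta-number, it would fall strictly
  between two consecutive ones, and a rim hook of length \<open>t\<close> could be removed.\<close>

lemma core_beta_closed:
  assumes "is_core t \<pi>" and "t > 0"
  shows "\<exists>k. beta \<pi> k = beta \<pi> i - int t"
proof (rule ccontr)
  assume no: "\<not> ?thesis"
  have part: "is_partition \<pi>" using assms by (simp add: is_core_def)
  \<comment> \<open>An index this far out lies in the tail of empty rows; it ensures that the least
    index \<open>m\<close> below exists.\<close>
  have "beta \<pi> (length \<pi> + i + t) \<le> beta \<pi> i - int t" by (simp add: beta_def row_def)
  define m where "m = (LEAST m. beta \<pi> m \<le> beta \<pi> i - int t)"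
  have m: "beta \<pi> m \<le> beta \<pi> i - int t" unfolding m_def by (rule LeastI) fact
  have "i < m"
  proof (rule ccontr)
    assume "\<not> i < m"
    then have "beta \<pi> i \<le> beta \<pi> m"
      using beta_strict_decreasing[OF part, of m i] by (cases "i = m") auto
    then show False using m assms(2) by simp
  qed
  then obtain k where k: "m = Suc k" "i \<le> k" by (metis less_imp_Suc_add le_add1)
  have 1: "beta \<pi> k > beta \<pi> i - int t"
    using not_less_Least[of k "\<lambda>m. beta \<pi> m \<le> beta \<pi> i - int t"] k by (simp add: m_def[symmetric])
  have 2: "beta \<pi> (Suc k) < beta \<pi> i - int t" using m no k by (metis order_le_less)
  \<comment> \<open>The length left in row \<open>k\<close> so that
    \<open>p - k = beta \<pi> i - t\<close>; fact 2 keeps the subtraction from truncating.\<close>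
  define p where "p = row \<pi> i + k - i - t"
  have "p + i + t = row \<pi> i + k" using 2 k by (simp add: beta_def p_def)
  moreover from this have "row \<pi> (Suc k) \<le> p" "p < row \<pi> k" using 1 2 by (simp_all add: beta_def)
  ultimately show False
    using rim_hook_exists[OF part k(2)] assms(1) by (auto simp: is_core_def)
qed

section \<open>The positions gained when a core is shifted by t\<close>

text \<open>
  Here \<open>B\<close> is the part above \<open>- n\<close> of a set of integers \<open>X\<close> that contains everything up to \<open>- n\<close>, and the
  result is \<open>(X + t) - X\<close>.
\<close>

definition new_positions :: "int \<Rightarrow> int \<Rightarrow> int set \<Rightarrow> int set" where
  "new_positions t n B = ((\<lambda>b. b + t) ` B \<union> {1 - n..t - n}) - B"

text \<open>Closure puts \<open>B\<close> inside the union, and the two sets united are disjoint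
  because \<open>b + t > t - n\<close> for \<open>b\<close> in \<open>B\<close>; so the sums simply
  add and subtract.\<close>

lemma sum_new_positions:
  fixes h :: "int \<Rightarrow> 'a::ab_group_add"
  assumes "finite B" and low: "\<And>b. b \<in> B \<Longrightarrow> - n < b"
    and closed: "\<And>b. b \<in> B \<Longrightarrow> b - t \<in> B \<or> b - t \<le> - n"
  shows "sum h (new_positions t n B) = (\<Sum>b\<in>B. h (b + t)) + sum h {1 - n..t - n} - sum h B"
proof -
  have "B \<subseteq> (\<lambda>b. b + t) ` B \<union> {1 - n..t - n}"
  proof
    fix b assume b: "b \<in> B"
    have "b = b - t + t" by simp
    then show "b \<in> (\<lambda>b. b + t) ` B \<union> {1 - n..t - n}" using closed[OF b] low[OF b] by force
  qed
  then have "sum h (new_positions t n B) = sum h ((\<lambda>b. b + t) ` B \<union> {1 - n..t - n}) - sum h B"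
    unfolding new_positions_def using assms(1) by (intro sum_diff) auto
  also have "sum h ((\<lambda>b. b + t) ` B \<union> {1 - n..t - n}) = sum h ((\<lambda>b. b + t) ` B) + sum h {1 - n..t - n}"
    using assms(1) low by (intro sum.union_disjoint) fastforce+
  also have "sum h ((\<lambda>b. b + t) ` B) = (\<Sum>b\<in>B. h (b + t))"
    by (subst sum.reindex) (auto simp: inj_on_def)
  finally show ?thesis .
qed

definition core_positions :: "nat \<Rightarrow> nat list \<Rightarrow> int set" where
  "core_positions t \<pi> = new_positions (int t) (int (length \<pi>)) (beta \<pi> ` {..<length \<pi>})"

text \<open>The constant \<open>h = 1\<close> and the identity make the right-hand side vanish,
  which fixes the size and the sum of the set for every core; powers of the root of unity bring in
  the rank.\<close>

lemma sum_core_positions: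
  fixes h :: "int \<Rightarrow> 'a::ab_group_add"
  assumes "is_core t \<pi>" and "t > 0"
  shows "sum h (core_positions t \<pi>) - sum h {1..int t} =
    (\<Sum>i<length \<pi>. h (beta \<pi> i + int t) - h (beta \<pi> i)) - (\<Sum>i<length \<pi>. h (- int i + int t) - h (- int i))"
proof -
  define n where "n = length \<pi>"
  have part: "is_partition \<pi>" using assms by (simp add: is_core_def)
  have "inj_on (beta \<pi>) {..<n}"
    by (rule inj_onI) (metis beta_strict_decreasing[OF part] linorder_neqE_nat less_irrefl)
  moreover have "sum h (core_positions t \<pi>) = (\<Sum>b\<in>beta \<pi> ` {..<n}. h (b + int t))
      + sum h {1 - int n..int t - int n} - sum h (beta \<pi> ` {..<n})"
    unfolding core_positions_def n_def[symmetric]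
  proof (rule sum_new_positions)
    fix b assume "b \<in> beta \<pi> ` {..<n}"
    then obtain i where i: "i < n" "b = beta \<pi> i" by auto
    show "- int n < b" using i by (simp add: beta_def)
    obtain k where k: "beta \<pi> k = b - int t" using core_beta_closed[OF assms] i by blast
    show "b - int t \<in> beta \<pi> ` {..<n} \<or> b - int t \<le> - int n"
    proof (cases "k < n")
      case False
      then have "beta \<pi> k \<le> - int n" by (simp add: beta_def row_def n_def)
      then show ?thesis using k by simp
    qed (metis imageI k lessThan_iff)
  qed simp
  \<comment> \<open>The same formula for the empty partition padded to \<open>n\<close> zero rows,
    whose new positions are \<open>{1..t}\<close>. The interval terms cancel in the
    comparison.\<close>
  moreover have "sum h {1..int t} = (\<Sum>b\<in>(\<lambda>i. - int i) ` {..<n}. h (b + int t))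
      + sum h {1 - int n..int t - int n} - sum h ((\<lambda>i. - int i) ` {..<n})"
  proof -
    have im: "(\<lambda>i. - int i) ` {..<n} = {1 - int n..0}"
    proof
      show "{1 - int n..0} \<subseteq> (\<lambda>i. - int i) ` {..<n}"
      proof
        fix b assume "b \<in> {1 - int n..0}"
        then have "b = - int (nat (- b))" "nat (- b) < n" by auto
        then show "b \<in> (\<lambda>i. - int i) ` {..<n}" by blast
      qed
    qed auto
    have "(\<lambda>b. b + int t) ` {1 - int n..0} = {1 - int n + int t..int t}"
      by (simp add: image_add_atLeastAtMost')
    then have "new_positions (int t) (int n) {1 - int n..0} = {1..int t}"
      by (auto simp: new_positions_def)
    moreover have "sum h (new_positions (int t) (int n) {1 - int n..0}) = (\<Sum>b\<in>{1 - int n..0}. h (b + int t))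
      + sum h {1 - int n..int t - int n} - sum h {1 - int n..0}"
      by (rule sum_new_positions) auto
    ultimately show ?thesis by (simp only: im)
  qed
  moreover have "inj_on (\<lambda>i. - int i) {..<n}" by (auto simp: inj_on_def)
  ultimately show ?thesis
    by (simp add: sum.reindex sum_subtractf n_def)
qed

lemma card_core_positions:
  assumes "is_core t \<pi>" and "t > 0"
  shows "card (core_positions t \<pi>) = t"
  using sum_core_positions[OF assms, of "\<lambda>_. 1 :: int"] by simp

lemma sum_id_core_positions:
  assumes "is_core t \<pi>" and "t > 0"
  shows "\<Sum>(core_positions t \<pi>) = \<Sum>{1..int t}"
  using sum_core_positions[OF assms, of "\<lambda>c. c"] by simp

lemma GBG_rank_core_positions:
  assumes "is_core t \<pi>" and "t > 0" and "s > 0"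
  defines "w \<equiv> root_unity s"
  shows "(w ^ t - 1) * ((w - 1) * GBG_rank \<pi> s) =
    (\<Sum>c\<in>core_positions t \<pi>. w powi c) - (\<Sum>c\<in>{1..int t}. w powi c)"
proof -
  have "w \<noteq> 0" by (simp add: w_def root_unity_def)
  then have "w powi (c + int t) - w powi c = (w ^ t - 1) * w powi c" for c
    by (simp add: power_int_add algebra_simps)
  then show ?thesis
    unfolding sum_core_positions[OF assms(1,2)]
    by (simp only: GBG_rank_beta[OF assms(3)] w_def right_diff_distrib sum_distrib_left)
qed

section \<open>Residues of the positions and the final count\<close>

definition residue_list :: "nat \<Rightarrow> int set \<Rightarrow> nat list" where
  "residue_list s C = map (\<lambda>k. card {c \<in> C. nat (c mod int s) = k}) [0..<s]"

lemma sum_residue_list: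
  fixes h :: "nat \<Rightarrow> 'b::semiring_1"
  assumes "finite C" "s > 0"
  shows "(\<Sum>k<s. of_nat (residue_list s C ! k) * h k) = (\<Sum>c\<in>C. h (nat (c mod int s)))"
  by (subst sum_fibers[of C _ s]) (use assms in \<open>auto simp: residue_list_def nat_less_iff\<close>)

lemma residue_list_properties:
  assumes "finite C" "s > 0"
  shows "length (residue_list s C) = s" "sum_list (residue_list s C) = card C"
    and "[int (weight (residue_list s C)) = \<Sum>C] (mod int s)"
proof -
  show len: "length (residue_list s C) = s" by (simp add: residue_list_def)
  show "sum_list (residue_list s C) = card C"
    using sum_residue_list[OF assms, of "\<lambda>_. 1 :: nat"] len
    by (simp add: sum_list_sum_nth atLeast0LessThan)
  have "weight (residue_list s C) = (\<Sum>c\<in>C. nat (c mod int s))"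
    using sum_residue_list[OF assms, of "\<lambda>k. k"] len by (simp add: weight_def mult.commute)
  then have "int (weight (residue_list s C)) = (\<Sum>c\<in>C. c mod int s)"
    using assms by simp
  then show "[int (weight (residue_list s C)) = \<Sum>C] (mod int s)"
    by (simp add: cong_def mod_sum_eq)
qed

theorem theorem1p2:
  fixes s t :: nat
  assumes "s > 1" and "t > 1" and "gcd s t = 1"
  shows "finite (core_ranks s t) \<and>
         real (nu s t) \<le> 1 / real (t + s) * real ((t + s) choose t)"
proof -
  define w where "w = root_unity s"
  \<comment> \<open>The sum of the position set, common to all \<open>t\<close>-cores.\<close>
  define a where "a = \<Sum>{1..t}"
  define E where "E = {l. length l = s \<and> sum_list l = t \<and> [weight l = a] (mod s)}"
  \<comment> \<open>Recovers the rank from the multiplicities of residues by solving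
    \<open>GBG_rank_core_positions\<close> for it; the denominator is nonzero since \<open>s\<close>
    divides neither \<open>t\<close> nor 1.\<close>
  define F where "F l = ((\<Sum>k<s. of_nat (l ! k) * w ^ k) - (\<Sum>c\<in>{1..int t}. w powi c)) / ((w ^ t - 1) * (w - 1))"
    for l :: "nat list"
  have pos: "s > 0" "t > 0" using assms by auto
  have cop: "coprime s t" using assms by (simp add: coprime_iff_gcd_eq_1)
  have "\<not> s dvd t"
    using assms by (metis gcd_nat.absorb_iff1 less_irrefl)
  then have w: "w ^ t \<noteq> 1" "w \<noteq> 1"
    using root_unity_power_eq_1_iff[OF pos(1), of t] root_unity_power_eq_1_iff[OF pos(1), of 1] assms
    by (auto simp: w_def)
  have "core_ranks s t \<subseteq> F ` E"
  proof
    fix z assume "z \<in> core_ranks s t"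
    then obtain \<pi> where \<pi>: "is_core t \<pi>" "z = GBG_rank \<pi> s" by (auto simp: core_ranks_def)
    define C where "C = core_positions t \<pi>"
    have "card C = t" using card_core_positions[OF \<pi>(1) pos(2)] by (simp add: C_def)
    then have fin: "finite C" using pos by (metis card.infinite less_irrefl)
    note props = residue_list_properties[OF fin pos(1)]
    have "int a = \<Sum>{1..int t}"
      using image_int_atLeastAtMost[of 1 t] sum.reindex[of int "{1..t}" "\<lambda>c. c"] by (simp add: a_def)
    then have "[int (weight (residue_list s C)) = int a] (mod int s)"
      using props(3) sum_id_core_positions[OF \<pi>(1) pos(2)] by (simp add: C_def)
    then have "residue_list s C \<in> E"
      using props \<open>card C = t\<close> by (simp add: E_def cong_int_iff)
    moreover have "w ^ nat (c mod int s) = w powi c" for c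
      using root_unity_powi_cong[OF pos(1), of c "c mod int s"] pos
      by (simp add: w_def power_int_def)
    then have "(\<Sum>k<s. of_nat (residue_list s C ! k) * w ^ k) = (\<Sum>c\<in>C. w powi c)"
      by (simp only: sum_residue_list[OF fin pos(1), of "\<lambda>k. w ^ k"])
    then have "F (residue_list s C) = ((w ^ t - 1) * ((w - 1) * z)) / ((w ^ t - 1) * (w - 1))"
      using GBG_rank_core_positions[OF \<pi>(1) pos(2,1)] by (simp only: F_def C_def w_def \<pi>(2))
    then have "F (residue_list s C) = z" using w by simp
    ultimately show "z \<in> F ` E" by blast
  qed
  moreover have "finite E"
    by (rule finite_subset[OF _ finite_lists_sum[of s t]]) (auto simp: E_def)
  ultimately have fin: "finite (core_ranks s t)" and "nu s t \<le> card E"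
    unfolding nu_def by (auto intro: finite_subset surj_card_le)
  then have "s * nu s t \<le> (t + s - 1) choose t"
    using card_lists_weight[OF pos(1) cop, of a] unfolding E_def[symmetric]
    by (meson mult_le_mono2 le_trans)
  \<comment> \<open>Absorption:
    \<open>(t + s) * ((t + s - 1) choose t) = s * ((t + s) choose t)\<close>, after which the factor
    \<open>s\<close> cancels.\<close>
  then have "(t + s) * (s * nu s t) \<le> s * ((t + s) choose t)"
    using binomial_absorb_comp[of "t + s" t] by simp
  then have "(t + s) * nu s t \<le> (t + s) choose t"
    using pos by (simp add: mult.left_commute)
  then have "real (t + s) * real (nu s t) \<le> real ((t + s) choose t)"
    by (metis of_nat_le_iff of_nat_mult)
  then show ?thesis using fin pos by (simp add: field_simps)
qed

end
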